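(* Let $X$ be a locally compact Hausdorff space. The following statements are equivalent: (a) $C_0(X)$ is order complete. (b) $C_0(X)$ has the projection property. (c) $X$ is extremally disconnected.
   Context: $C_0(X)$ is the Banach lattice of continuous real-valued functions on $X$ vanishing at infinity, with the supremum norm and pointwise order. A vector lattice is order complete if every nonempty subset bounded above has a supremum. An order ideal in a vector lattice $E$ is a linear subspace $Y$ such that $0\le |x|\le |y|$ with $x\in E$, $y\in Y$ implies $x\in Y$. A band $B$ in $E$ is an order ideal such that whenever $(x_\alpha)$ is a net in $B$ with $0\le x_\alpha\nearrow x$ in $E$ (increasing with supremum $x$ in $E$), then $x\in B$. With $B^d=\{x\in E: |x|\wedge |b|=0\text{ for all } b\in B\}$, a band $B$ is a projection band if $E=B\oplus B^d$. $E$ has the projection property if every band in $E$ is a projection band. A topological space is extremally disconnected if the closure of every open set is open. *)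

theory Defs
  imports "HOL-Analysis.Analysis" "HOL-Library.Function_Algebras"
begin

text \<open>Real-valued functions form a vector lattice under the pointwise operations and order. The
  lattice and the ordered group structure come from the libraries, the scalar multiplication
  is added here.\<close>

instantiation "fun" :: (type, real_vector) real_vector
begin

definition "r *\<^sub>R f = (\<lambda>x. r *\<^sub>R f x)"

instance
  by standard (simp_all add: scaleR_fun_def fun_eq_iff scaleR_add_right scaleR_add_left)

end

instance "fun" :: (type, ordered_real_vector) ordered_real_vector
  by standard (auto simp: scaleR_fun_def le_fun_def intro: scaleR_left_mono scaleR_right_mono)

text \<open>A vector lattice is represented by its carrier \<open>E\<close>, a linear sublattice of an ambient vector
  lattice. Suprema of arbitrary subsets are always taken in \<open>E\<close>, not in the ambient type.\<close>

definition vector_sublattice :: "'b::{ordered_real_vector,lattice} set \<Rightarrow> bool" where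
  "vector_sublattice E \<longleftrightarrow>
     subspace E \<and> (\<forall>x\<in>E. \<forall>y\<in>E. sup x y \<in> E \<and> inf x y \<in> E)"

definition modulus :: "'b::{ordered_real_vector,lattice} \<Rightarrow> 'b" where
  "modulus x = sup x (- x)"

definition is_supremum_in :: "'b::order set \<Rightarrow> 'b set \<Rightarrow> 'b \<Rightarrow> bool" where
  "is_supremum_in E A s \<longleftrightarrow>
     s \<in> E \<and> (\<forall>a\<in>A. a \<le> s) \<and> (\<forall>u\<in>E. (\<forall>a\<in>A. a \<le> u) \<longrightarrow> s \<le> u)"

definition order_complete :: "'b::order set \<Rightarrow> bool" where
  "order_complete E \<longleftrightarrow>
     (\<forall>A. A \<subseteq> E \<and> A \<noteq> {} \<and> (\<exists>u\<in>E. \<forall>a\<in>A. a \<le> u) \<longrightarrow> (\<exists>s. is_supremum_in E A s))"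

definition order_ideal :: "'b::{ordered_real_vector,lattice} set \<Rightarrow> 'b set \<Rightarrow> bool" where
  "order_ideal E Y \<longleftrightarrow>
     Y \<subseteq> E \<and> subspace Y \<and>
     (\<forall>x\<in>E. \<forall>y\<in>Y. 0 \<le> modulus x \<and> modulus x \<le> modulus y \<longrightarrow> x \<in> Y)"

definition directed_by :: "'i set \<Rightarrow> ('i \<Rightarrow> 'i \<Rightarrow> bool) \<Rightarrow> bool" where
  "directed_by I r \<longleftrightarrow>
     I \<noteq> {} \<and> reflp_on I r \<and> transp_on I r \<and> (\<forall>i\<in>I. \<forall>j\<in>I. \<exists>k\<in>I. r i k \<and> r j k)"

definition increases_to ::
    "'b::order set \<Rightarrow> 'i set \<Rightarrow> ('i \<Rightarrow> 'i \<Rightarrow> bool) \<Rightarrow> ('i \<Rightarrow> 'b) \<Rightarrow> 'b \<Rightarrow> bool" where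
  "increases_to E I r x s \<longleftrightarrow>
     directed_by I r \<and> monotone_on I r (\<le>) x \<and> is_supremum_in E (x ` I) s"

text \<open>A definition cannot quantify over all index types. The index sets of the nets below are taken
  in the ambient type itself; by the lemma \<open>band_net\<close> this covers nets over every directed set,
  since an increasing net can be replaced by its range.\<close>

definition band :: "'b::{ordered_real_vector,lattice} set \<Rightarrow> 'b set \<Rightarrow> bool" where
  "band E B \<longleftrightarrow>
     order_ideal E B \<and>
     (\<forall>(I::'b set) r x s.
        (\<forall>i\<in>I. x i \<in> B \<and> 0 \<le> x i) \<and> increases_to E I r x s \<longrightarrow> s \<in> B)"

lemma band_net:
  fixes I :: "'i set" and E :: "'b::{ordered_real_vector,lattice} set"
  assumes "band E B" and x: "\<And>i. i \<in> I \<Longrightarrow> x i \<in> B \<and> 0 \<le> x i" and inc: "increases_to E I r x s"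
  shows "s \<in> B"
proof -
  have "directed_by (x ` I) (\<le>)"
    unfolding directed_by_def
  proof (intro conjI ballI)
    show "x ` I \<noteq> {}" using inc by (auto simp: increases_to_def directed_by_def)
    show "reflp_on (x ` I) (\<le>)" "transp_on (x ` I) (\<le>)"
      by (auto simp: reflp_on_def transp_on_def)
    fix a b assume "a \<in> x ` I" "b \<in> x ` I"
    then obtain i j where "i \<in> I" "j \<in> I" "a = x i" "b = x j" by auto
    moreover from this inc obtain k where "k \<in> I" "r i k" "r j k"
      unfolding increases_to_def directed_by_def by blast
    ultimately show "\<exists>c\<in>x ` I. a \<le> c \<and> b \<le> c"
      using inc unfolding increases_to_def monotone_on_def by blast
  qed
  then have "increases_to E (x ` I) (\<le>) id s"
    using inc by (simp add: increases_to_def monotone_on_def)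
  moreover have "\<forall>a\<in>x ` I. id a \<in> B \<and> 0 \<le> id a" using x by auto
  ultimately show ?thesis using assms(1) unfolding band_def by blast
qed

definition disjoint_complement ::
    "'b::{ordered_real_vector,lattice} set \<Rightarrow> 'b set \<Rightarrow> 'b set" where
  "disjoint_complement E B = {x \<in> E. \<forall>b\<in>B. inf (modulus x) (modulus b) = 0}"

definition projection_band :: "'b::{ordered_real_vector,lattice} set \<Rightarrow> 'b set \<Rightarrow> bool" where
  "projection_band E B \<longleftrightarrow>
     band E B \<and>
     E = {b + c | b c. b \<in> B \<and> c \<in> disjoint_complement E B} \<and>
     B \<inter> disjoint_complement E B = {0}"

definition projection_property :: "'b::{ordered_real_vector,lattice} set \<Rightarrow> bool" where
  "projection_property E \<longleftrightarrow> (\<forall>B. band E B \<longrightarrow> projection_band E B)"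

text \<open>The value \<open>0\<close> outside \<open>topspace X\<close> makes functions on \<open>topspace X\<close> correspond uniquely to
  elements of the function type, compatibly with the pointwise operations and order.\<close>

definition C0 :: "'a topology \<Rightarrow> ('a \<Rightarrow> real) set" where
  "C0 X = {f. continuous_map X euclideanreal f \<and>
              (\<forall>e>0. compactin X {x \<in> topspace X. e \<le> \<bar>f x\<bar>}) \<and>
              (\<forall>x. x \<notin> topspace X \<longrightarrow> f x = 0)}"

lemma C0_vanish_bound:
  assumes f: "f \<in> C0 X" and g: "g \<in> C0 X"
    and h: "continuous_map X euclideanreal h" "\<And>x. x \<notin> topspace X \<Longrightarrow> h x = 0"
    and le: "\<And>x. \<bar>h x\<bar> \<le> c * (\<bar>f x\<bar> + \<bar>g x\<bar>)" and c: "0 < c"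
  shows "h \<in> C0 X"
proof -
  have "compactin X {x \<in> topspace X. e \<le> \<bar>h x\<bar>}" if e: "e > 0" for e
  proof (rule closed_compactin)
    define d where "d = e / (2 * c)"
    have d: "d > 0" using e c by (simp add: d_def)
    show "compactin X ({x \<in> topspace X. d \<le> \<bar>f x\<bar>} \<union> {x \<in> topspace X. d \<le> \<bar>g x\<bar>})"
      using f g d by (auto simp: C0_def intro!: compactin_Un)
    show "{x \<in> topspace X. e \<le> \<bar>h x\<bar>} \<subseteq>
        {x \<in> topspace X. d \<le> \<bar>f x\<bar>} \<union> {x \<in> topspace X. d \<le> \<bar>g x\<bar>}"
    proof clarify
      fix x assume "e \<le> \<bar>h x\<bar>" and n: "\<not> d \<le> \<bar>g x\<bar>"
      then have "2 * c * d \<le> c * (\<bar>f x\<bar> + \<bar>g x\<bar>)" using le[of x] c by (simp add: d_def)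
      then have "c * (2 * d) \<le> c * (\<bar>f x\<bar> + \<bar>g x\<bar>)" by (simp add: mult_ac)
      then have "2 * d \<le> \<bar>f x\<bar> + \<bar>g x\<bar>" using c mult_le_cancel_left_pos by blast
      with n show "d \<le> \<bar>f x\<bar>" by linarith
    qed
    have "closedin X {x \<in> topspace X. h x \<in> {y. e \<le> \<bar>y\<bar>}}"
      by (rule closedin_continuous_map_preimage[OF h(1)])
         (auto intro!: closed_Collect_le continuous_intros)
    then show "closedin X {x \<in> topspace X. e \<le> \<bar>h x\<bar>}" by simp
  qed
  then show ?thesis using h by (simp add: C0_def)
qed

lemma vector_sublattice_C0: "vector_sublattice (C0 X)"
proof -
  have 0: "0 \<in> C0 X"
    by (auto simp: C0_def zero_fun_def)
  have cont: "continuous_map X euclideanreal f" if "f \<in> C0 X" for f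
    using that by (simp add: C0_def)
  have out: "f x = 0" if "f \<in> C0 X" "x \<notin> topspace X" for f x
    using that by (simp add: C0_def)
  have "f + g \<in> C0 X" if "f \<in> C0 X" "g \<in> C0 X" for f g
    by (rule C0_vanish_bound[OF that, of _ 1])
       (auto simp: plus_fun_def that out cont intro!: continuous_map_add)
  moreover have "r *\<^sub>R f \<in> C0 X" if "f \<in> C0 X" for r f
    by (rule C0_vanish_bound[OF that 0, of _ "\<bar>r\<bar> + 1"])
       (auto simp: scaleR_fun_def abs_mult mult_right_mono that out cont
             intro!: continuous_map_real_mult_left)
  moreover have "sup f g \<in> C0 X" if "f \<in> C0 X" "g \<in> C0 X" for f g
    by (rule C0_vanish_bound[OF that, of _ 1])
       (auto simp: sup_fun_def sup_real_def that out cont intro!: continuous_map_real_max)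
  moreover have "inf f g \<in> C0 X" if "f \<in> C0 X" "g \<in> C0 X" for f g
    by (rule C0_vanish_bound[OF that, of _ 1])
       (auto simp: inf_fun_def inf_real_def that out cont intro!: continuous_map_real_min)
  ultimately show ?thesis
    using 0 by (simp add: vector_sublattice_def subspace_def)
qed

definition extremally_disconnected :: "'a topology \<Rightarrow> bool" where
  "extremally_disconnected X \<longleftrightarrow> (\<forall>U. openin X U \<longrightarrow> openin X (X closure_of U))"

end

theory Submission
  imports Defs
begin

text \<open>Order completeness gives the projection property because the component of \<open>f \<ge> 0\<close> in a band
  \<open>B\<close> is the supremum of all \<open>b \<in> B\<close> with \<open>0 \<le> b \<le> f\<close>. Given the projection property, apply it
  to the band of functions vanishing off the closure of an open set \<open>U\<close>: the component of \<open>f\<close> in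
  this band agrees with \<open>f\<close> on the closure and vanishes off it, so the closure is open. Finally, if
  \<open>X\<close> is extremally disconnected, the closures of the sets \<open>{x. \<exists>a\<in>A. t < a x}\<close> are clopen, and
  they are essentially the superlevel sets of a continuous function, which is the supremum of \<open>A\<close>.\<close>

section \<open>Lattices of real-valued functions\<close>

lemma modulus_real_fun: "modulus f = (\<lambda>x. \<bar>f x :: real\<bar>)"
  by (auto simp: modulus_def fun_eq_iff sup_real_def abs_real_def)

lemma order_ideal_real_funD:
  fixes Y :: "('a \<Rightarrow> real) set"
  assumes "order_ideal E Y" "f \<in> E" "g \<in> Y" "\<And>x. \<bar>f x\<bar> \<le> \<bar>g x\<bar>"
  shows "f \<in> Y"
proof -
  have "0 \<le> modulus f" "modulus f \<le> modulus g"
    using assms(4) by (simp_all add: modulus_real_fun le_fun_def)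
  with assms show ?thesis by (auto simp: order_ideal_def)
qed

lemma disjoint_complement_real_fun:
  fixes B :: "('a \<Rightarrow> real) set"
  shows "disjoint_complement E B = {f \<in> E. \<forall>b\<in>B. \<forall>x. f x = 0 \<or> b x = 0}"
proof -
  have "inf \<bar>s\<bar> \<bar>t\<bar> = 0 \<longleftrightarrow> s = 0 \<or> t = 0" for s t :: real
    by (auto simp: inf_real_def min_def)
  then show ?thesis
    by (simp add: disjoint_complement_def modulus_real_fun fun_eq_iff)
qed

text \<open>The members of \<open>B\<close> between \<open>0\<close> and \<open>f\<close> form a
  directed set, so their supremum \<open>p\<close> lies in \<open>B\<close>. If \<open>f - p\<close>
  overlapped some \<open>b\<close> in \<open>B\<close>, the overlap could be added to every member
  of that set without leaving it, and \<open>p\<close> would not be an upper bound.\<close>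

lemma band_component_nonneg:
  fixes E :: "('a \<Rightarrow> real) set"
  assumes E: "vector_sublattice E" and oc: "order_complete E" and B: "band E B"
    and f: "f \<in> E" "0 \<le> f"
  obtains p where "p \<in> B" "f - p \<in> disjoint_complement E B"
proof -
  have ideal: "order_ideal E B" using B by (simp add: band_def)
  have subE: "subspace E" and infE: "\<And>g h. g \<in> E \<Longrightarrow> h \<in> E \<Longrightarrow> inf g h \<in> E"
    and supE: "\<And>g h. g \<in> E \<Longrightarrow> h \<in> E \<Longrightarrow> sup g h \<in> E"
    using E by (auto simp: vector_sublattice_def)
  have subB: "subspace B" and BE: "B \<subseteq> E" using ideal by (auto simp: order_ideal_def)
  define I where "I = {b \<in> B. 0 \<le> b \<and> b \<le> f}"
  have I0: "0 \<in> I" using subB f(2) by (auto simp: I_def subspace_0)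
  moreover have "I \<subseteq> E" using BE by (auto simp: I_def)
  moreover have "\<exists>u\<in>E. \<forall>a\<in>I. a \<le> u" using f(1) by (auto simp: I_def)
  ultimately obtain p where p: "is_supremum_in E I p"
    using oc unfolding order_complete_def by blast
  then have pE: "p \<in> E" and upper: "\<And>b. b \<in> I \<Longrightarrow> b \<le> p"
    and least: "\<And>u. u \<in> E \<Longrightarrow> (\<And>b. b \<in> I \<Longrightarrow> b \<le> u) \<Longrightarrow> p \<le> u"
    by (auto simp: is_supremum_in_def)
  have pf: "p \<le> f" using f(1) by (intro least) (auto simp: I_def)
  \<comment> \<open>For nonnegative \<open>a\<close> and \<open>b\<close> the supremum is dominated
    by \<open>a + b\<close>, so the ideal property puts it in \<open>B\<close>.\<close>
  have sup_I: "sup a b \<in> I" if ab: "a \<in> I" "b \<in> I" for a b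
  proof -
    have "a + b \<in> B" using ab subB by (auto simp: I_def subspace_add)
    moreover have "sup a b \<in> E" using ab BE supE by (auto simp: I_def)
    moreover have "\<bar>sup a b x\<bar> \<le> \<bar>(a + b) x\<bar>" for x
    proof -
      have "0 \<le> a x" "0 \<le> b x" using ab by (simp_all add: I_def le_fun_def)
      then show ?thesis by (simp add: sup_real_def max_def)
    qed
    ultimately have "sup a b \<in> B" using order_ideal_real_funD[OF ideal] by blast
    then show ?thesis using ab by (auto simp: I_def intro: le_supI1)
  qed
  have "directed_by I (\<le>)"
    unfolding directed_by_def
  proof (intro conjI ballI)
    show "I \<noteq> {}" using I0 by auto
    show "reflp_on I (\<le>)" "transp_on I (\<le>)" by (auto simp: reflp_on_def transp_on_def)
    show "\<exists>c\<in>I. a \<le> c \<and> b \<le> c" if "a \<in> I" "b \<in> I" for a b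
      using sup_I[OF that] by (intro bexI[of _ "sup a b"]) auto
  qed
  \<comment> \<open>The directed set \<open>I\<close> serves as its own index set, with the identity
    as the net.\<close>
  then have "increases_to E I (\<le>) id p"
    using p by (simp add: increases_to_def monotone_on_def)
  then have pB: "p \<in> B"
    using band_net[OF B, of I id] by (auto simp: I_def)
  have fpE: "f - p \<in> E" using subE f(1) pE by (rule subspace_diff)
  have "f - p \<in> disjoint_complement E B"
    unfolding disjoint_complement_real_fun
  proof (intro CollectI conjI ballI allI)
    fix b x assume b: "b \<in> B"
    \<comment> \<open>The overlap of the remainder \<open>f - p\<close> with \<open>b\<close>: it
      lies in \<open>B\<close> because \<open>b\<close> dominates it, and
      \<open>p + c \<le> f\<close>.\<close>
    define c where "c = inf (f - p) (modulus b)"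
    have c_apply: "c y = min (f y - p y) \<bar>b y\<bar>" for y
      by (simp add: c_def modulus_real_fun inf_real_def)
    have c0: "0 \<le> c y" for y
      using pf by (simp add: c_apply le_fun_def)
    have "- b \<in> E" "b \<in> E" using b BE subE by (auto simp: subspace_neg)
    then have "modulus b \<in> E" by (simp add: modulus_def supE)
    with fpE have "c \<in> E" by (simp add: c_def infE)
    moreover have "\<bar>c y\<bar> \<le> \<bar>b y\<bar>" for y
      using c0[of y] by (simp add: c_apply)
    ultimately have cB: "c \<in> B" using order_ideal_real_funD[OF ideal _ b] by simp
    \<comment> \<open>Adding \<open>c\<close> maps \<open>I\<close> into itself, so
      \<open>p - c\<close> is again an upper bound of \<open>I\<close>. As \<open>c\<close> is
      nonnegative, leastness of \<open>p\<close> forces it to vanish.\<close>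
    have "p \<le> p - c"
    proof (rule least)
      show "p - c \<in> E" using subE pE \<open>c \<in> E\<close> by (rule subspace_diff)
      fix a assume a: "a \<in> I"
      have "a y + c y \<le> f y" for y
      proof -
        have "a y \<le> p y" using upper[OF a] by (simp add: le_fun_def)
        moreover have "c y \<le> f y - p y" by (simp add: c_apply)
        ultimately show ?thesis by linarith
      qed
      moreover have "0 \<le> a y + c y" for y
        using a c0[of y] by (simp add: I_def le_fun_def)
      ultimately have "a + c \<in> I"
        using a cB subB by (simp add: I_def subspace_add le_fun_def)
      then have "a + c \<le> p" by (rule upper)
      then show "a \<le> p - c" by (simp add: le_diff_eq)
    qed
    then have "c x \<le> 0" by (simp add: le_fun_def)
    with c0[of x] have "min (f x - p x) \<bar>b x\<bar> = 0" by (simp add: c_apply)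
    then show "(f - p) x = 0 \<or> b x = 0" by (auto simp: min_def split: if_splits)
  qed (rule fpE)
  with pB show ?thesis by (rule that)
qed

text \<open>Components are available for nonnegative functions, so \<open>f\<close> is written as
  the difference of its positive part \<open>g\<close> and its negative part \<open>h\<close>, and
  their components are subtracted. The intersection is trivial because a function disjoint from
  itself is zero.\<close>

lemma order_complete_imp_projection_property:
  fixes E :: "('a \<Rightarrow> real) set"
  assumes E: "vector_sublattice E" and oc: "order_complete E"
  shows "projection_property E"
  unfolding projection_property_def projection_band_def
proof (intro allI impI conjI)
  fix B assume B: "band E B"
  show "band E B" by (rule B)
  have subE: "subspace E" and supE: "\<And>g h. g \<in> E \<Longrightarrow> h \<in> E \<Longrightarrow> sup g h \<in> E"
    using E by (auto simp: vector_sublattice_def)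
  have subB: "subspace B" and BE: "B \<subseteq> E"
    using B by (auto simp: band_def order_ideal_def)
  show "B \<inter> disjoint_complement E B = {0}"
  proof
    show "B \<inter> disjoint_complement E B \<subseteq> {0}"
      by (auto simp: disjoint_complement_real_fun fun_eq_iff)
    show "{0} \<subseteq> B \<inter> disjoint_complement E B"
      using subE subB by (auto simp: disjoint_complement_real_fun subspace_0)
  qed
  show "E = {b + c |b c. b \<in> B \<and> c \<in> disjoint_complement E B}"
  proof (intro equalityI subsetI)
    fix f assume f: "f \<in> E"
    define g where "g = sup f 0"
    define h where "h = sup (- f) 0"
    have g: "g \<in> E" "0 \<le> g" and h: "h \<in> E" "0 \<le> h"
      using f subE by (auto simp: g_def h_def supE subspace_0 subspace_neg)
    obtain p where p: "p \<in> B" "g - p \<in> disjoint_complement E B"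
      using band_component_nonneg[OF E oc B g] .
    obtain q where q: "q \<in> B" "h - q \<in> disjoint_complement E B"
      using band_component_nonneg[OF E oc B h] .
    have "f = (p - q) + ((g - p) - (h - q))"
      by (auto simp: fun_eq_iff g_def h_def sup_real_def max_def)
    moreover have "p - q \<in> B" using p q subB by (simp add: subspace_diff)
    moreover have "(g - p) - (h - q) \<in> disjoint_complement E B"
      unfolding disjoint_complement_real_fun
    proof (intro CollectI conjI ballI allI)
      show "(g - p) - (h - q) \<in> E"
        using p q subE by (simp add: disjoint_complement_def subspace_diff)
      fix b x assume "b \<in> B"
      then have "(g - p) x = 0 \<or> b x = 0" "(h - q) x = 0 \<or> b x = 0"
        using p q by (auto simp: disjoint_complement_real_fun)
      then show "((g - p) - (h - q)) x = 0 \<or> b x = 0" by auto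
    qed
    ultimately show "f \<in> {b + c |b c. b \<in> B \<and> c \<in> disjoint_complement E B}" by blast
  next
    fix f assume "f \<in> {b + c |b c. b \<in> B \<and> c \<in> disjoint_complement E B}"
    then show "f \<in> E"
      using BE subE by (auto simp: disjoint_complement_def intro!: subspace_add)
  qed
qed

section \<open>Functions on locally compact Hausdorff spaces\<close>

text \<open>Locally compact Hausdorff spaces are completely regular, so \<open>x\<close> can be
  separated from the complement of \<open>V\<close> by a continuous function.\<close>

lemma bump_exists:
  assumes "locally_compact_space X" "Hausdorff_space X" "openin X V" "x \<in> V"
  obtains f where "continuous_map X euclideanreal f" "f x = 1"
    "\<And>y. 0 \<le> f y \<and> f y \<le> 1" "\<And>y. y \<notin> V \<Longrightarrow> f y = 0"
proof -
  have "completely_regular_space X"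
    using assms by (simp add: locally_compact_regular_imp_completely_regular_space)
  moreover have "closedin X (topspace X - V)" "x \<in> topspace X - (topspace X - V)"
    using assms openin_subset[OF assms(3)] by auto
  ultimately obtain g where g: "continuous_map X (top_of_set {0..1::real}) g" "g x = 0"
    "g ` (topspace X - V) \<subseteq> {1}"
    unfolding completely_regular_space_def by meson
  \<comment> \<open>The separating function is controlled only on \<open>topspace X\<close>; the
    default \<open>0\<close> secures the bounds and the vanishing off \<open>V\<close> at every
    point of the type.\<close>
  define f where "f y = (if y \<in> topspace X then 1 - g y else 0)" for y
  have gc: "continuous_map X euclideanreal g" and g01: "\<And>y. y \<in> topspace X \<Longrightarrow> 0 \<le> g y \<and> g y \<le> 1"
    using g(1) by (auto simp: continuous_map_in_subtopology image_subset_iff Pi_iff)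
  have "continuous_map X euclideanreal (\<lambda>y. 1 - g y)"
    using gc by (intro continuous_intros) auto
  then have "continuous_map X euclideanreal f"
    by (rule continuous_map_eq) (simp add: f_def)
  then show ?thesis
    using g assms openin_subset[OF assms(3)] g01
    by (intro that[of f]) (auto simp: f_def)
qed

text \<open>A bump supported in \<open>V \<inter> W\<close>, with \<open>W\<close> inside a compact
  set \<open>K\<close>, vanishes at infinity: the sets where its modulus is at least
  \<open>e > 0\<close> are closed subsets of \<open>K\<close>.\<close>

lemma C0_bump_exists:
  assumes X: "locally_compact_space X" "Hausdorff_space X" and V: "openin X V" "x \<in> V"
  obtains f where "f \<in> C0 X" "f x = 1" "\<And>y. y \<notin> V \<Longrightarrow> f y = 0"
proof -
  have "x \<in> topspace X" using V openin_subset by blast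
  then obtain W K where W: "openin X W" "compactin X K" "x \<in> W" "W \<subseteq> K"
    using X(1) unfolding locally_compact_space_def by meson
  have "openin X (V \<inter> W)" "x \<in> V \<inter> W" using V W by auto
  then obtain f where f: "continuous_map X euclideanreal f" "f x = 1"
    "\<And>y. y \<notin> V \<inter> W \<Longrightarrow> f y = 0"
    using bump_exists[OF X, of "V \<inter> W" x] by metis
  have "compactin X {y \<in> topspace X. e \<le> \<bar>f y\<bar>}" if "e > 0" for e
  proof (rule closed_compactin[OF W(2)])
    show "{y \<in> topspace X. e \<le> \<bar>f y\<bar>} \<subseteq> K"
      using f(3) W(4) \<open>e > 0\<close> by fastforce
    have "closedin X {y \<in> topspace X. f y \<in> {t. e \<le> \<bar>t\<bar>}}"
      by (rule closedin_continuous_map_preimage[OF f(1)])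
         (auto intro!: closed_Collect_le continuous_intros)
    then show "closedin X {y \<in> topspace X. e \<le> \<bar>f y\<bar>}" by simp
  qed
  moreover have "f y = 0" if "y \<notin> topspace X" for y
    using f(3) that openin_subset[OF V(1)] by auto
  ultimately have "f \<in> C0 X" using f(1) by (auto simp: C0_def)
  then show ?thesis by (rule that) (use f in auto)
qed

text \<open>A supremum taken in \<open>C0 X\<close> need not be pointwise, so vanishing on
  \<open>V\<close> does not pass to it at once. Since \<open>V\<close> is open, the supremum can be
  pushed down near any point of \<open>V\<close> by a bump and still bound the net.\<close>

lemma band_vanishing_on_open:
  assumes X: "locally_compact_space X" "Hausdorff_space X" and V: "openin X V"
  shows "band (C0 X) {f \<in> C0 X. \<forall>x\<in>V. f x = 0}" (is "band ?E ?B")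
  unfolding band_def
proof (intro conjI allI impI)
  have subE: "subspace ?E" using vector_sublattice_C0 by (auto simp: vector_sublattice_def)
  show "order_ideal ?E ?B"
    unfolding order_ideal_def
  proof (intro conjI ballI impI)
    show "subspace ?B"
      using subE by (auto simp: subspace_def scaleR_fun_def)
    fix f g assume f: "f \<in> ?E" and g: "g \<in> ?B" and le: "0 \<le> modulus f \<and> modulus f \<le> modulus g"
    have "\<bar>f x\<bar> \<le> \<bar>g x\<bar>" for x using le by (simp add: modulus_real_fun le_fun_def)
    moreover from this have "f x = 0" if "g x = 0" for x
      using that by (metis abs_le_zero_iff abs_zero)
    ultimately show "f \<in> ?B" using f g by simp
  qed auto
  fix I :: "('a \<Rightarrow> real) set" and r n s
  assume asm: "(\<forall>i\<in>I. n i \<in> ?B \<and> 0 \<le> n i) \<and> increases_to ?E I r n s"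
  then have sE: "s \<in> ?E" and up: "\<And>i. i \<in> I \<Longrightarrow> n i \<le> s" and ne: "I \<noteq> {}"
    and least: "\<And>u. u \<in> ?E \<Longrightarrow> (\<And>i. i \<in> I \<Longrightarrow> n i \<le> u) \<Longrightarrow> s \<le> u"
    by (auto simp: increases_to_def is_supremum_in_def directed_by_def)
  have s0: "0 \<le> s y" for y
  proof -
    obtain i where i: "i \<in> I" using ne by blast
    then have "0 \<le> n i" using asm by blast
    with up[OF i] have "0 \<le> s" by (rule order_trans[rotated])
    then show ?thesis by (simp add: le_fun_def)
  qed
  have "s x = 0" if x: "x \<in> V" for x
  proof -
    obtain h where h: "continuous_map X euclideanreal h" "h x = 1"
      "\<And>y. 0 \<le> h y \<and> h y \<le> 1" "\<And>y. y \<notin> V \<Longrightarrow> h y = 0"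
      using bump_exists[OF X V x] by blast
    \<comment> \<open>Inside \<open>V\<close> the net is zero and \<open>u\<close> is nonnegative;
      outside \<open>V\<close> nothing changes. So \<open>u\<close> is an upper bound in
      \<open>C0 X\<close>, and it vanishes at \<open>x\<close>.\<close>
    define u where "u = (\<lambda>y. s y * (1 - h y))"
    have "u \<in> C0 X"
    proof (rule C0_vanish_bound[OF sE sE, of _ 1])
      show "continuous_map X euclideanreal u"
        using h(1) sE unfolding u_def C0_def by (intro continuous_intros) auto
      show "u y = 0" if "y \<notin> topspace X" for y using sE that by (simp add: C0_def u_def)
      show "\<bar>u y\<bar> \<le> 1 * (\<bar>s y\<bar> + \<bar>s y\<bar>)" for y
      proof -
        have "\<bar>s y\<bar> * \<bar>1 - h y\<bar> \<le> \<bar>s y\<bar> * 1" using h(3)[of y] by (intro mult_left_mono) auto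
        then show ?thesis by (simp add: u_def abs_mult)
      qed
    qed simp
    moreover have "n i \<le> u" if i: "i \<in> I" for i
    proof (rule le_funI)
      fix y
      show "n i y \<le> u y"
      proof (cases "y \<in> V")
        case True
        then have "n i y = 0" using asm i by auto
        then show ?thesis using s0[of y] h(3)[of y] by (simp add: u_def)
      next
        case False
        then show ?thesis using up[OF i] h(4) by (simp add: u_def le_fun_def)
      qed
    qed
    ultimately have "s \<le> u" by (rule least)
    then have "s x \<le> u x" by (simp add: le_fun_def)
    then show ?thesis using s0[of x] h(2) by (simp add: u_def)
  qed
  with sE show "s \<in> ?B" by simp
qed

text \<open>For \<open>x\<close> in the closure \<open>K\<close>, decompose a function with value
  \<open>1\<close> at \<open>x\<close>. Its band component \<open>b\<close> keeps the value
  \<open>1\<close> at \<open>x\<close> and vanishes off \<open>K\<close>, so the set where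
  \<open>b\<close> is nonzero is an open neighbourhood of \<open>x\<close> inside
  \<open>K\<close>.\<close>

lemma projection_property_imp_extremally_disconnected:
  assumes X: "locally_compact_space X" "Hausdorff_space X"
    and pp: "projection_property (C0 X)"
  shows "extremally_disconnected X"
  unfolding extremally_disconnected_def
proof (intro allI impI)
  fix U assume U: "openin X U"
  define K where "K = X closure_of U"
  have UK: "U \<subseteq> K" and KX: "K \<subseteq> topspace X"
    using U by (auto simp: K_def closure_of_subset openin_subset closure_of_subset_topspace)
  define B where "B = {f \<in> C0 X. \<forall>x\<in>topspace X - K. f x = 0}"
  have "band (C0 X) B"
    unfolding B_def by (rule band_vanishing_on_open[OF X]) (simp add: K_def openin_diff)
  then have C0_split: "C0 X = {b + c |b c. b \<in> B \<and> c \<in> disjoint_complement (C0 X) B}"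
    using pp unfolding projection_property_def projection_band_def by blast
  have "\<exists>T. openin X T \<and> x \<in> T \<and> T \<subseteq> K" if x: "x \<in> K" for x
  proof -
    have "openin X (topspace X)" "x \<in> topspace X" using x KX by auto
    then obtain f where f: "f \<in> C0 X" "f x = 1"
      using C0_bump_exists[OF X] by metis
    then obtain b c where fbc: "f = b + c" and b: "b \<in> B"
      and c: "c \<in> disjoint_complement (C0 X) B"
      using C0_split by blast
    have c_cont: "continuous_map X euclideanreal c" and b_cont: "continuous_map X euclideanreal b"
      using b c by (simp_all add: B_def disjoint_complement_def C0_def)
    \<comment> \<open>Bumps supported in \<open>U\<close> belong to \<open>B\<close>, so
      \<open>c\<close>, being disjoint from them, vanishes on \<open>U\<close>, and by continuity on
      \<open>K\<close>.\<close>
    have "c y = 0" if y: "y \<in> U" for y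
    proof -
      obtain g where g: "g \<in> C0 X" "g y = 1" "\<And>z. z \<notin> U \<Longrightarrow> g z = 0"
        using C0_bump_exists[OF X U y] by blast
      then have "g \<in> B" using UK by (auto simp: B_def)
      then have "c y = 0 \<or> g y = 0" using c by (auto simp: disjoint_complement_real_fun)
      then show ?thesis using g(2) by simp
    qed
    moreover have "closedin X {y \<in> topspace X. c y \<in> {0}}"
      by (rule closedin_continuous_map_preimage[OF c_cont]) simp
    ultimately have "K \<subseteq> {y \<in> topspace X. c y \<in> {0}}"
      unfolding K_def using U by (intro closure_of_minimal) (auto dest: openin_subset)
    then have "b x = 1" using x f(2) fbc by auto
    moreover have "openin X {y \<in> topspace X. b y \<in> - {0}}"
      by (rule openin_continuous_map_preimage[OF b_cont]) (simp add: open_Compl)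
    moreover have "{y \<in> topspace X. b y \<in> - {0}} \<subseteq> K"
      using b by (auto simp: B_def)
    ultimately show ?thesis
      using x KX by (intro exI[of _ "{y \<in> topspace X. b y \<in> - {0}}"]) auto
  qed
  then show "openin X (X closure_of U)"
    unfolding K_def[symmetric] by (subst openin_subopen) blast
qed

section \<open>Suprema in extremally disconnected spaces\<close>

text \<open>Strict superlevel sets are unions of sets \<open>W t\<close>, and strict sublevel sets
  are unions of their complements. Openness of \<open>W t\<close> gives lower semicontinuity,
  closedness gives upper semicontinuity.\<close>

lemma continuous_map_Sup_clopen_levels:
  fixes W :: "real \<Rightarrow> 'a set"
  assumes clopen: "\<And>t. openin X (W t)" "\<And>t. closedin X (W t)"
    and anti: "\<And>s t. s \<le> t \<Longrightarrow> W t \<subseteq> W s"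
    and ne: "\<And>x. x \<in> topspace X \<Longrightarrow> \<exists>t. x \<in> W t"
    and bdd: "\<And>x. x \<in> topspace X \<Longrightarrow> bdd_above {t. x \<in> W t}"
  shows "continuous_map X euclideanreal (\<lambda>x. Sup {t. x \<in> W t})"
  unfolding continuous_map_upper_lower_semicontinuous_lt
proof (intro conjI allI)
  fix r
  have lt: "r < Sup {t. x \<in> W t} \<longleftrightarrow> (\<exists>t>r. x \<in> W t)" if "x \<in> topspace X" for x
    using less_cSup_iff[of "{t. x \<in> W t}" r] ne[OF that] bdd[OF that] by auto
  have "{x \<in> topspace X. r < Sup {t. x \<in> W t}} = (\<Union>t\<in>{r<..}. W t)"
    using lt openin_subset[OF clopen(1)] by fastforce
  also have "openin X \<dots>" using clopen(1) by blast
  finally show "openin X {x \<in> topspace X. r < Sup {t. x \<in> W t}}" .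
  have gt: "Sup {t. x \<in> W t} < r \<longleftrightarrow> (\<exists>t<r. x \<notin> W t)" if x: "x \<in> topspace X" for x
  proof
    assume "Sup {t. x \<in> W t} < r"
    \<comment> \<open>The supremum may be attained, so a level strictly above it is chosen.\<close>
    then obtain t where t: "Sup {t. x \<in> W t} < t" "t < r" using dense by blast
    then have "x \<notin> W t" using cSup_upper[OF _ bdd[OF x], of t] by auto
    with t show "\<exists>t<r. x \<notin> W t" by blast
  next
    assume "\<exists>t<r. x \<notin> W t"
    then obtain t where t: "t < r" "x \<notin> W t" by blast
    then have "s \<le> t" if "x \<in> W s" for s using that anti[of t s] by force
    then have "Sup {t. x \<in> W t} \<le> t" using ne[OF x] by (intro cSup_least) auto
    with t show "Sup {t. x \<in> W t} < r" by simp
  qed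
  have "{x \<in> topspace X. Sup {t. x \<in> W t} < r} = (\<Union>t\<in>{..<r}. topspace X - W t)"
    using gt by auto
  also have "openin X \<dots>" using clopen(2) by (intro openin_Union) auto
  finally show "openin X {x \<in> topspace X. Sup {t. x \<in> W t} < r}" .
qed

lemma extremally_disconnected_imp_order_complete:
  assumes ed: "extremally_disconnected X"
  shows "order_complete (C0 X)"
  unfolding order_complete_def
proof (intro allI impI)
  fix A assume "A \<subseteq> C0 X \<and> A \<noteq> {} \<and> (\<exists>u\<in>C0 X. \<forall>a\<in>A. a \<le> u)"
  then obtain a0 u0 where A: "A \<subseteq> C0 X" and a0: "a0 \<in> A"
    and u0: "u0 \<in> C0 X" "\<forall>a\<in>A. a \<le> u0" by blast
  have cont: "continuous_map X euclideanreal f" if "f \<in> C0 X" for f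
    using that by (simp add: C0_def)
  have out: "f x = 0" if "f \<in> C0 X" "x \<notin> topspace X" for f x
    using that by (simp add: C0_def)
  define S where "S t = {x \<in> topspace X. \<exists>a\<in>A. t < a x}" for t
  define W where "W t = X closure_of S t" for t
  have S_open: "openin X (S t)" for t
  proof -
    have "S t = (\<Union>a\<in>A. {x \<in> topspace X. a x \<in> {t<..}})" by (auto simp: S_def)
    moreover have "openin X {x \<in> topspace X. a x \<in> {t<..}}" if "a \<in> A" for a
      using that A by (intro openin_continuous_map_preimage[OF cont]) auto
    ultimately show ?thesis by auto
  qed
  have SW: "S t \<subseteq> W t" for t
    unfolding W_def by (rule closure_of_subset) (auto simp: S_def)
  \<comment> \<open>An upper bound \<open>u\<close> is at least \<open>t\<close> on
    \<open>S t\<close>, and the set where this holds is closed, so passing to the closure costs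
    nothing. This later yields both finiteness and leastness of \<open>s\<close>.\<close>
  have W_le: "t \<le> u x" if u: "u \<in> C0 X" "\<forall>a\<in>A. a \<le> u" and x: "x \<in> W t" for u t x
  proof -
    have "closedin X {x \<in> topspace X. u x \<in> {t..}}"
      by (rule closedin_continuous_map_preimage[OF cont[OF u(1)]]) simp
    moreover have "S t \<subseteq> {x \<in> topspace X. u x \<in> {t..}}"
    proof
      fix y assume "y \<in> S t"
      then obtain a where "y \<in> topspace X" "a \<in> A" "t < a y" by (auto simp: S_def)
      moreover have "a y \<le> u y" using u(2) \<open>a \<in> A\<close> by (simp add: le_fun_def)
      ultimately show "y \<in> {x \<in> topspace X. u x \<in> {t..}}" by simp
    qed
    ultimately have "W t \<subseteq> {x \<in> topspace X. u x \<in> {t..}}"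
      unfolding W_def by (intro closure_of_minimal)
    with x show ?thesis by auto
  qed
  have W_ne: "\<exists>t. x \<in> W t" if "x \<in> topspace X" for x
  proof
    \<comment> \<open>Any level strictly below \<open>a0 x\<close> would do.\<close>
    have "x \<in> S (a0 x - 1)" using that a0 by (force simp: S_def)
    then show "x \<in> W (a0 x - 1)" using SW by blast
  qed
  have W_bdd: "bdd_above {t. x \<in> W t}" for x
    using W_le[OF u0] by (intro bdd_aboveI[of _ "u0 x"]) auto
  \<comment> \<open>No level set meets the outside of \<open>topspace X\<close>, where the formula
    would give the supremum of the empty set; membership in \<open>C0 X\<close> demands
    \<open>0\<close> there.\<close>
  define s where "s x = (if x \<in> topspace X then Sup {t. x \<in> W t} else 0)" for x
  have "continuous_map X euclideanreal (\<lambda>x. Sup {t. x \<in> W t})"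
  proof (rule continuous_map_Sup_clopen_levels)
    show "openin X (W t)" for t
      using ed S_open by (simp add: extremally_disconnected_def W_def)
    show "closedin X (W t)" for t by (simp add: W_def)
    show "W t \<subseteq> W r" if "r \<le> t" for r t
      unfolding W_def using that by (intro closure_of_mono) (force simp: S_def)
  qed (use W_ne W_bdd in auto)
  then have s_cont: "continuous_map X euclideanreal s"
    by (rule continuous_map_eq) (simp add: s_def)
  have upper: "a \<le> s" if a: "a \<in> A" for a
  proof (rule le_funI)
    fix x
    show "a x \<le> s x"
    proof (cases "x \<in> topspace X")
      case True
      show ?thesis
      proof (rule dense_le)
        fix t assume "t < a x"
        then have "x \<in> W t" using SW True a by (force simp: S_def)
        then show "t \<le> s x" using True W_bdd by (simp add: s_def cSup_upper)
      qed
    next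
      case False
      then show ?thesis using a A out[of a x] by (auto simp: s_def)
    qed
  qed
  have least: "s \<le> u" if u: "u \<in> C0 X" "\<forall>a\<in>A. a \<le> u" for u
  proof (rule le_funI)
    fix x
    show "s x \<le> u x"
      using W_ne[of x] W_le[OF u] out[OF u(1), of x] by (auto simp: s_def intro!: cSup_least)
  qed
  have "s \<in> C0 X"
  \<comment> \<open>Being squeezed between \<open>a0\<close> and \<open>u0\<close>, the function
    \<open>s\<close> inherits vanishing at infinity from them.\<close>
  proof (rule C0_vanish_bound[of a0 X u0 s 1])
    show "\<bar>s x\<bar> \<le> 1 * (\<bar>a0 x\<bar> + \<bar>u0 x\<bar>)" for x
    proof -
      have "a0 x \<le> s x" "s x \<le> u0 x"
        using upper[OF a0] least[OF u0] by (simp_all add: le_fun_def)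
      then have "\<bar>s x\<bar> \<le> \<bar>a0 x\<bar> + \<bar>u0 x\<bar>" by linarith
      then show ?thesis by simp
    qed
  qed (use a0 A u0 s_cont in \<open>auto simp: s_def\<close>)
  then show "\<exists>s. is_supremum_in (C0 X) A s"
    using upper least by (auto simp: is_supremum_in_def)
qed

theorem theorem6p2:
  fixes X :: "'a topology"
  assumes "locally_compact_space X" and "Hausdorff_space X"
  shows "(order_complete (C0 X) \<longleftrightarrow> projection_property (C0 X)) \<and>
         (projection_property (C0 X) \<longleftrightarrow> extremally_disconnected X)"
  using order_complete_imp_projection_property[OF vector_sublattice_C0]
    projection_property_imp_extremally_disconnected[OF assms]
    extremally_disconnected_imp_order_complete
  by blast

end
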